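(* Let $X\subseteq\mathbb{R}$ be a nonempty set with $x+1\in X$ whenever $x\in X$, let $\lambda_0,s_0$ be functions on $X$, and define functions $\lambda_k, s_k$ on $X$ for $k\ge 1$ recursively by $$\lambda_k(x)=\Delta \lambda_{k-1}(x)+\lambda_{k-1}(x+1)\lambda_0(x)+s_{k-1}(x+1),\qquad s_k(x)=\Delta s_{k-1}(x)+\lambda_{k-1}(x+1)s_0(x).$$ Let $n\ge 1$ be an integer. If the second-order difference equation $$\Delta^2 y(x)=\lambda_0(x)\,\Delta y(x)+s_0(x)\,y(x)\qquad (x\in X)$$ has a polynomial solution of degree $n$, then $$s_n(x)\lambda_{n-1}(x)-s_{n-1}(x)\lambda_n(x)=0\qquad\text{for all } x\in X.$$
   Context: $\Delta$ is the forward difference operator, $\Delta f(x)=f(x+1)-f(x)$, and $\Delta^2=\Delta\circ\Delta$. Functions are real (or complex) valued. A polynomial solution of degree $n$ is a solution that is the restriction to $X$ of a polynomial in $x$ of degree exactly $n$. *)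

theory Defs
  imports Complex_Main "HOL-Computational_Algebra.Polynomial"
begin

text \<open>
  Functions on a set \<open>X\<close> of reals closed under \<open>x \<mapsto> x + 1\<close> are represented by total functions
  on \<^typ>\<open>real\<close>; at points of \<open>X\<close> every notion below depends only on values in \<open>X\<close>.
  The class \<^class>\<open>real_normed_field\<close> covers real-valued and complex-valued functions at once.
\<close>

definition fdiff :: "(real \<Rightarrow> 'a::real_normed_field) \<Rightarrow> real \<Rightarrow> 'a"
  where "fdiff f x = f (x + 1) - f x"

fun lambda_seq :: "(real \<Rightarrow> 'a::real_normed_field) \<Rightarrow> (real \<Rightarrow> 'a) \<Rightarrow> nat \<Rightarrow> real \<Rightarrow> 'a"
  and s_seq :: "(real \<Rightarrow> 'a::real_normed_field) \<Rightarrow> (real \<Rightarrow> 'a) \<Rightarrow> nat \<Rightarrow> real \<Rightarrow> 'a"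
where
  "lambda_seq l0 s0 0 = l0"
| "lambda_seq l0 s0 (Suc k) =
     (\<lambda>x. fdiff (lambda_seq l0 s0 k) x + lambda_seq l0 s0 k (x + 1) * l0 x + s_seq l0 s0 k (x + 1))"
| "s_seq l0 s0 0 = s0"
| "s_seq l0 s0 (Suc k) =
     (\<lambda>x. fdiff (s_seq l0 s0 k) x + lambda_seq l0 s0 k (x + 1) * s0 x)"

definition is_solution_on ::
    "real set \<Rightarrow> (real \<Rightarrow> 'a::real_normed_field) \<Rightarrow> (real \<Rightarrow> 'a) \<Rightarrow> (real \<Rightarrow> 'a) \<Rightarrow> bool"
  where "is_solution_on X l0 s0 y \<longleftrightarrow>
    (\<forall>x\<in>X. fdiff (fdiff y) x = l0 x * fdiff y x + s0 x * y x)"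

definition is_polynomial_on :: "real set \<Rightarrow> nat \<Rightarrow> (real \<Rightarrow> 'a::real_normed_field) \<Rightarrow> bool"
  where "is_polynomial_on X n y \<longleftrightarrow>
    (\<exists>p :: 'a poly. p \<noteq> 0 \<and> degree p = n \<and> (\<forall>x\<in>X. y x = poly p (of_real x)))"

end

theory Submission
  imports Defs
begin

text \<open>
  Differencing the equation repeatedly gives
  \<open>\<Delta>\<^sup>k\<^sup>+\<^sup>2 y = \<lambda>\<^sub>k \<Delta>y + s\<^sub>k y\<close>. For a polynomial \<open>y\<close> of degree \<open>n\<close> the left-hand side vanishes for
  \<open>k = n - 1\<close> and \<open>k = n\<close>, so \<open>(\<Delta>y(x), y(x))\<close> lies in the kernel of a two by two matrix whose
  determinant is, up to sign, the asserted expression. This vector is nonzero: otherwise the equation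
  propagates \<open>y = \<Delta>y = 0\<close> to \<open>x + 1, x + 2, \<dots>\<close>, and \<open>y\<close> would have infinitely many roots.
\<close>

text \<open>Iterated differences at \<open>x\<close> read only values at \<open>x\<close>,
  \<open>x + 1\<close>, and so on, all in \<open>X\<close>. This allows \<open>y\<close> to be
  exchanged for a polynomial with which it agrees on \<open>X\<close> only.\<close>

lemma fdiff_funpow_cong:
  assumes closed: "\<And>x. x \<in> X \<Longrightarrow> x + 1 \<in> X"
    and eq: "\<And>x. x \<in> X \<Longrightarrow> f x = g x"
    and "x \<in> X"
  shows "(fdiff ^^ k) f x = (fdiff ^^ k) g x"
  using \<open>x \<in> X\<close>
proof (induction k arbitrary: x)
  case (Suc k)
  then show ?case by (simp add: fdiff_def closed)
qed (simp add: eq)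

lemma fdiff_mult:
  "fdiff (\<lambda>x. f x * g x) x = fdiff f x * g x + f (x + 1) * fdiff g x"
  by (simp add: fdiff_def algebra_simps)

lemma fdiff_add: "fdiff (\<lambda>x. f x + g x) x = fdiff f x + fdiff g x"
  by (simp add: fdiff_def)

lemma fdiff_poly:
  fixes p :: "'a::real_normed_field poly"
  shows "fdiff (\<lambda>x. poly p (of_real x)) = (\<lambda>x. poly (p \<circ>\<^sub>p [:1, 1:] - p) (of_real x))"
  by (simp add: fun_eq_iff fdiff_def poly_pcompose add.commute)

text \<open>A unit shift keeps the degree and the leading coefficient, so the top terms cancel. The
  first alternative covers constants.\<close>

lemma degree_pcompose_shift_diff:
  fixes p :: "'a::idom poly"
  shows "p \<circ>\<^sub>p [:1, 1:] - p = 0 \<or> degree (p \<circ>\<^sub>p [:1, 1:] - p) < degree p"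
proof (cases "degree p = 0")
  case True
  then show ?thesis by (auto elim!: degree_eq_zeroE)
next
  case False
  have "coeff (p \<circ>\<^sub>p [:1, 1:]) (degree p) = coeff p (degree p)"
    using lead_coeff_comp[of "[:1, 1:]" p] by (simp add: degree_pcompose)
  then have "coeff (p \<circ>\<^sub>p [:1, 1:] - p) (degree p) = 0"
    by simp
  moreover have "degree (p \<circ>\<^sub>p [:1, 1:] - p) \<le> degree p"
    by (rule degree_diff_le) (simp_all add: degree_pcompose)
  ultimately show ?thesis
    using False by (metis eq_zero_or_degree_less)
qed

lemma fdiff_funpow_poly_eq_0:
  fixes p :: "'a::real_normed_field poly"
  assumes "p = 0 \<or> degree p < k"
  shows "(fdiff ^^ k) (\<lambda>x. poly p (of_real x)) = (\<lambda>x. 0)"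
  using assms
proof (induction k arbitrary: p)
  case (Suc k)
  have "p \<circ>\<^sub>p [:1, 1:] - p = 0 \<or> degree (p \<circ>\<^sub>p [:1, 1:] - p) < k"
    using degree_pcompose_shift_diff[of p] Suc.prems by auto
  then show ?case
    \<comment> \<open>Peeling off the innermost difference leaves a polynomial again, of smaller
      degree or zero.\<close>
    by (simp only: funpow_Suc_right o_apply fdiff_poly Suc.IH)
qed simp

text \<open>The product rule \<open>fdiff_mult\<close> puts the shift on the coefficient, which is
  the source of the arguments \<open>x + 1\<close> in the recursion.\<close>

lemma fdiff_funpow_solution:
  assumes closed: "\<And>x. x \<in> X \<Longrightarrow> x + 1 \<in> X"
    and sol: "is_solution_on X l0 s0 y"
    and "x \<in> X"
  shows "(fdiff ^^ (k + 2)) y x = lambda_seq l0 s0 k x * fdiff y x + s_seq l0 s0 k x * y x"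
  using \<open>x \<in> X\<close>
proof (induction k arbitrary: x)
  case 0
  then show ?case using sol by (simp add: is_solution_on_def numeral_2_eq_2)
next
  case (Suc k)
  let ?L = "lambda_seq l0 s0 k" and ?S = "s_seq l0 s0 k"
  have "(fdiff ^^ (Suc k + 2)) y x = fdiff ((fdiff ^^ (k + 2)) y) x"
    by simp
  also have "\<dots> = fdiff (\<lambda>x. ?L x * fdiff y x + ?S x * y x) x"
    \<comment> \<open>Only the outer difference is unfolded, so the induction hypothesis applies at
      both \<open>x\<close> and \<open>x + 1\<close>.\<close>
    unfolding fdiff_def[of "(fdiff ^^ (k + 2)) y"]
      fdiff_def[of "\<lambda>x. ?L x * fdiff y x + ?S x * y x"]
    by (simp only: Suc.IH closed Suc.prems)
  also have "\<dots> = fdiff ?L x * fdiff y x + ?L (x + 1) * fdiff (fdiff y) x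
      + (fdiff ?S x * y x + ?S (x + 1) * fdiff y x)"
    by (simp only: fdiff_add fdiff_mult)
  also have "fdiff (fdiff y) x = l0 x * fdiff y x + s0 x * y x"
    using sol Suc.prems by (simp add: is_solution_on_def)
  finally show ?case by (simp add: algebra_simps)
qed

lemma solution_zero_propagates:
  assumes closed: "\<And>x. x \<in> X \<Longrightarrow> x + 1 \<in> X"
    and sol: "is_solution_on X l0 s0 y"
    and "x \<in> X" "y x = 0" "fdiff y x = 0"
  shows "x + real k \<in> X \<and> y (x + real k) = 0 \<and> fdiff y (x + real k) = 0"
proof (induction k)
  case 0
  then show ?case using assms by simp
next
  case (Suc k)
  let ?z = "x + real k"
  have "fdiff (fdiff y) ?z = 0"
    using sol Suc by (simp add: is_solution_on_def)
  then have "fdiff y (?z + 1) = 0" "y (?z + 1) = 0"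
    using Suc by (auto simp: fdiff_def[of "fdiff y"] fdiff_def[of y ?z])
  moreover have "x + real (Suc k) = ?z + 1" by simp
  ultimately show ?case using Suc closed by metis
qed

lemma polynomial_solution_nontrivial:
  fixes y :: "real \<Rightarrow> 'a::real_normed_field"
  assumes closed: "\<And>x. x \<in> X \<Longrightarrow> x + 1 \<in> X"
    and sol: "is_solution_on X l0 s0 y"
    and "is_polynomial_on X n y" "x \<in> X"
  shows "y x \<noteq> 0 \<or> fdiff y x \<noteq> 0"
proof (rule ccontr)
  assume "\<not> ?thesis"
  then have zero: "x + real k \<in> X" "y (x + real k) = 0" for k
    using solution_zero_propagates[OF closed sol \<open>x \<in> X\<close>, of k] by auto
  obtain p :: "'a poly" where p: "p \<noteq> 0" "\<And>x. x \<in> X \<Longrightarrow> y x = poly p (of_real x)"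
    using assms(3) by (auto simp: is_polynomial_on_def)
  \<comment> \<open>The points \<open>x + k\<close> embed injectively into the field as roots of
    \<open>p\<close>.\<close>
  have "range (\<lambda>k. of_real (x + real k) :: 'a) \<subseteq> {z. poly p z = 0}"
    using zero p(2) by fastforce
  moreover have "infinite (range (\<lambda>k. of_real (x + real k) :: 'a))"
    by (rule range_inj_infinite) (simp add: inj_on_def)
  ultimately show False
    using poly_roots_finite[OF p(1)] finite_subset by blast
qed

text \<open>Cramer's rule: the determinant annihilates both \<open>u\<close> and \<open>v\<close>,
  and there are no zero divisors.\<close>

lemma det_eq_0_of_kernel:
  fixes a b c d u v :: "'a::idom"
  assumes "a * u + b * v = 0" "c * u + d * v = 0" "v \<noteq> 0 \<or> u \<noteq> 0"
  shows "d * a - b * c = 0"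
proof -
  have "(d * a - b * c) * u = d * (a * u + b * v) - b * (c * u + d * v)"
    "(d * a - b * c) * v = a * (c * u + d * v) - c * (a * u + b * v)"
    by (simp_all add: algebra_simps)
  then show ?thesis using assms by auto
qed

theorem theorem4p1:
  fixes X :: "real set"
    and l0 s0 :: "real \<Rightarrow> 'a::real_normed_field"
    and n :: nat
  assumes "X \<noteq> {}"
    and "\<And>x. x \<in> X \<Longrightarrow> x + 1 \<in> X"
    and "n \<ge> 1"
    and "\<exists>y. is_polynomial_on X n y \<and> is_solution_on X l0 s0 y"
  shows "\<forall>x\<in>X. s_seq l0 s0 n x * lambda_seq l0 s0 (n - 1) x
             - s_seq l0 s0 (n - 1) x * lambda_seq l0 s0 n x = 0"
proof
  fix x assume x: "x \<in> X"
  obtain y where poly: "is_polynomial_on X n y" and sol: "is_solution_on X l0 s0 y"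
    using assms(4) by blast
  obtain p :: "'a poly" where p: "degree p = n" "\<And>x. x \<in> X \<Longrightarrow> y x = poly p (of_real x)"
    using poly by (auto simp: is_polynomial_on_def)
  \<comment> \<open>The bound admits \<open>k = n - 1\<close> and \<open>k = n\<close>, the two rows
    of the matrix.\<close>
  have "lambda_seq l0 s0 k x * fdiff y x + s_seq l0 s0 k x * y x = 0" if "n < k + 2" for k
  proof -
    have "(fdiff ^^ (k + 2)) y x = (fdiff ^^ (k + 2)) (\<lambda>x. poly p (of_real x)) x"
      by (rule fdiff_funpow_cong[OF assms(2) p(2) x])
    also have "\<dots> = 0"
      using p(1) that by (subst fdiff_funpow_poly_eq_0) simp_all
    finally show ?thesis
      using fdiff_funpow_solution[OF assms(2) sol x] by simp
  qed
  then show "s_seq l0 s0 n x * lambda_seq l0 s0 (n - 1) x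
      - s_seq l0 s0 (n - 1) x * lambda_seq l0 s0 n x = 0"
    using polynomial_solution_nontrivial[OF assms(2) sol poly x] \<open>n \<ge> 1\<close>
    by (intro det_eq_0_of_kernel[where u = "fdiff y x" and v = "y x"]) simp_all
qed

end
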